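(* Let ${\cal D}$ be a deduction in ${\bf ND}_{\cal TML}$ in which the conclusion of every application of the rule $\bot$E is a propositional variable $p$ or its negation $\neg p$. Then ${\cal D}$ reduces (by conversions) to a normal deduction, i.e. there is a normal deduction in ${\bf ND}_{\cal TML}$ of the same conclusion whose open assumptions are among the open assumptions of ${\cal D}$.
   Context: Formulas are built from propositional variables and the constant $\bot$ using $\wedge,\vee,\neg,\square$. The natural deduction system ${\bf ND}_{\cal TML}$ has the rules (brackets indicate discharged assumptions): MA: infer $\phi\vee\neg\square\phi$ from no premises. $\wedge$I: from $\phi,\psi$ infer $\phi\wedge\psi$; $\wedge$E$_{1,2}$: from $\phi\wedge\psi$ infer $\phi$, resp. $\psi$. $\neg\wedge$I$_{1,2}$: from $\neg\phi$ (resp. $\neg\psi$) infer $\neg(\phi\wedge\psi)$; $\neg\wedge$E: from $\neg(\phi\wedge\psi)$, a deduction of $\chi$ from $[\neg\phi]$ and one of $\chi$ from $[\neg\psi]$, infer $\chi$. $\vee$I$_{1,2}$: from $\phi$ (resp. $\psi$) infer $\phi\vee\psi$; $\vee$E: from $\phi\vee\psi$, a deduction of $\chi$ from $[\phi]$ and one of $\chi$ from $[\psi]$, infer $\chi$. $\neg\vee$I: from $\neg\phi,\neg\psi$ infer $\neg(\phi\vee\psi)$; $\neg\vee$E$_{1,2}$: from $\neg(\phi\vee\psi)$ infer $\neg\phi$, resp. $\neg\psi$. $\neg\neg$I: from $\phi$ infer $\neg\neg\phi$; $\neg\neg$E: from $\neg\neg\phi$ infer $\phi$. $\square$I: from $\phi$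 and a deduction of $\bot$ from $[\neg\phi]$, infer $\square\phi$; $\square$E: from $\square\phi$ infer $\phi$. $\neg\square$I: from $\neg\phi$ infer $\neg\square\phi$; $\neg\square$E: from $\neg\square\phi$ and $\phi$ infer $\neg\phi$. $\bot$I: from $\neg\phi\wedge\square\phi$ infer $\bot$; $\bot$E: from $\bot$ infer any formula. The I-rules relevant for cuts are $\wedge$I, $\neg\wedge$I$_{1,2}$, $\vee$I$_{1,2}$, $\neg\vee$I, $\neg\neg$I, $\square$I, $\neg\square$I; the E-rules are $\wedge$E$_{1,2}$, $\neg\wedge$E, $\vee$E, $\neg\vee$E$_{1,2}$, $\neg\neg$E, $\square$E, $\neg\square$E, whose major premise is respectively $\phi\wedge\psi$, $\neg(\phi\wedge\psi)$, $\phi\vee\psi$, $\neg(\phi\vee\psi)$, $\neg\neg\phi$, $\square\phi$, $\neg\square\phi$; other premises are minor. The del-rules are $\vee$E and $\neg\wedge$E. A segment in a deduction is a sequence $\alpha_1,\dots,\alpha_n$ of consecutive occurrences of one formula such that for $i<n$, $\alpha_i$ is a minor premise of a del-rule application with conclusion $\alpha_{i+1}$, $\alpha_n$ is not a minor premise of a del-rule application, and $\alpha_1$ is not the conclusion of a del-rule application. A segment is a cut (maximal segment) if $\alpha_n$ is the major premise of an E-rule application and either $n>1$, or $n=1$ and $\alpha_1$ is the conclusion of an I-rule application. A deduction is normal if it contains no cuts. Reduction is by the standard conversions (detour conversions for each I/E pair and permutation of E-rules upward over minor premises of del-rules). *)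

theory Defs
  imports Main
begin

datatype 'v fm =
    Var 'v
  | Bot
  | And "'v fm" "'v fm"
  | Or "'v fm" "'v fm"
  | Neg "'v fm"
  | Box "'v fm"

text \<open>A rule instance is a rule name together with the formulas instantiating its metavariables,
  in the order \<open>\<phi>\<close>, \<open>\<psi>\<close>, \<open>\<chi>\<close>.\<close>

datatype 'v rule =
    MA "'v fm"
  | AndI "'v fm" "'v fm"
  | AndE1 "'v fm" "'v fm"
  | AndE2 "'v fm" "'v fm"
  | NegAndI1 "'v fm" "'v fm"
  | NegAndI2 "'v fm" "'v fm"
  | NegAndE "'v fm" "'v fm" "'v fm"
  | OrI1 "'v fm" "'v fm"
  | OrI2 "'v fm" "'v fm"
  | OrE "'v fm" "'v fm" "'v fm"
  | NegOrI "'v fm" "'v fm"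
  | NegOrE1 "'v fm" "'v fm"
  | NegOrE2 "'v fm" "'v fm"
  | NegNegI "'v fm"
  | NegNegE "'v fm"
  | BoxI "'v fm"
  | BoxE "'v fm"
  | NegBoxI "'v fm"
  | NegBoxE "'v fm"
  | BotI "'v fm"
  | BotE "'v fm"

text \<open>Each premise is a pair \<open>(\<Delta>, \<alpha>)\<close>: the deduction of \<open>\<alpha>\<close> may use the assumptions \<open>\<Delta>\<close>,
  which the rule discharges. The major premise of an E-rule always comes first.\<close>

fun prems :: "'v rule \<Rightarrow> ('v fm list \<times> 'v fm) list" where
  "prems (MA \<phi>) = []"
| "prems (AndI \<phi> \<psi>) = [([], \<phi>), ([], \<psi>)]"
| "prems (AndE1 \<phi> \<psi>) = [([], And \<phi> \<psi>)]"
| "prems (AndE2 \<phi> \<psi>) = [([], And \<phi> \<psi>)]"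
| "prems (NegAndI1 \<phi> \<psi>) = [([], Neg \<phi>)]"
| "prems (NegAndI2 \<phi> \<psi>) = [([], Neg \<psi>)]"
| "prems (NegAndE \<phi> \<psi> \<chi>) = [([], Neg (And \<phi> \<psi>)), ([Neg \<phi>], \<chi>), ([Neg \<psi>], \<chi>)]"
| "prems (OrI1 \<phi> \<psi>) = [([], \<phi>)]"
| "prems (OrI2 \<phi> \<psi>) = [([], \<psi>)]"
| "prems (OrE \<phi> \<psi> \<chi>) = [([], Or \<phi> \<psi>), ([\<phi>], \<chi>), ([\<psi>], \<chi>)]"
| "prems (NegOrI \<phi> \<psi>) = [([], Neg \<phi>), ([], Neg \<psi>)]"
| "prems (NegOrE1 \<phi> \<psi>) = [([], Neg (Or \<phi> \<psi>))]"
| "prems (NegOrE2 \<phi> \<psi>) = [([], Neg (Or \<phi> \<psi>))]"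
| "prems (NegNegI \<phi>) = [([], \<phi>)]"
| "prems (NegNegE \<phi>) = [([], Neg (Neg \<phi>))]"
| "prems (BoxI \<phi>) = [([], \<phi>), ([Neg \<phi>], Bot)]"
| "prems (BoxE \<phi>) = [([], Box \<phi>)]"
| "prems (NegBoxI \<phi>) = [([], Neg \<phi>)]"
| "prems (NegBoxE \<phi>) = [([], Neg (Box \<phi>)), ([], \<phi>)]"
| "prems (BotI \<phi>) = [([], And (Neg \<phi>) (Box \<phi>))]"
| "prems (BotE \<chi>) = [([], Bot)]"

fun rule_concl :: "'v rule \<Rightarrow> 'v fm" where
  "rule_concl (MA \<phi>) = Or \<phi> (Neg (Box \<phi>))"
| "rule_concl (AndI \<phi> \<psi>) = And \<phi> \<psi>"
| "rule_concl (AndE1 \<phi> \<psi>) = \<phi>"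
| "rule_concl (AndE2 \<phi> \<psi>) = \<psi>"
| "rule_concl (NegAndI1 \<phi> \<psi>) = Neg (And \<phi> \<psi>)"
| "rule_concl (NegAndI2 \<phi> \<psi>) = Neg (And \<phi> \<psi>)"
| "rule_concl (NegAndE \<phi> \<psi> \<chi>) = \<chi>"
| "rule_concl (OrI1 \<phi> \<psi>) = Or \<phi> \<psi>"
| "rule_concl (OrI2 \<phi> \<psi>) = Or \<phi> \<psi>"
| "rule_concl (OrE \<phi> \<psi> \<chi>) = \<chi>"
| "rule_concl (NegOrI \<phi> \<psi>) = Neg (Or \<phi> \<psi>)"
| "rule_concl (NegOrE1 \<phi> \<psi>) = Neg \<phi>"
| "rule_concl (NegOrE2 \<phi> \<psi>) = Neg \<psi>"
| "rule_concl (NegNegI \<phi>) = Neg (Neg \<phi>)"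
| "rule_concl (NegNegE \<phi>) = \<phi>"
| "rule_concl (BoxI \<phi>) = Box \<phi>"
| "rule_concl (BoxE \<phi>) = \<phi>"
| "rule_concl (NegBoxI \<phi>) = Neg (Box \<phi>)"
| "rule_concl (NegBoxE \<phi>) = Neg \<phi>"
| "rule_concl (BotI \<phi>) = Bot"
| "rule_concl (BotE \<chi>) = \<chi>"

fun is_I_rule :: "'v rule \<Rightarrow> bool" where
  "is_I_rule (AndI _ _) = True"
| "is_I_rule (NegAndI1 _ _) = True"
| "is_I_rule (NegAndI2 _ _) = True"
| "is_I_rule (OrI1 _ _) = True"
| "is_I_rule (OrI2 _ _) = True"
| "is_I_rule (NegOrI _ _) = True"
| "is_I_rule (NegNegI _) = True"
| "is_I_rule (BoxI _) = True"
| "is_I_rule (NegBoxI _) = True"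
| "is_I_rule _ = False"

fun is_E_rule :: "'v rule \<Rightarrow> bool" where
  "is_E_rule (AndE1 _ _) = True"
| "is_E_rule (AndE2 _ _) = True"
| "is_E_rule (NegAndE _ _ _) = True"
| "is_E_rule (OrE _ _ _) = True"
| "is_E_rule (NegOrE1 _ _) = True"
| "is_E_rule (NegOrE2 _ _) = True"
| "is_E_rule (NegNegE _) = True"
| "is_E_rule (BoxE _) = True"
| "is_E_rule (NegBoxE _) = True"
| "is_E_rule _ = False"

fun is_del_rule :: "'v rule \<Rightarrow> bool" where
  "is_del_rule (OrE _ _ _) = True"
| "is_del_rule (NegAndE _ _ _) = True"
| "is_del_rule _ = False"

text \<open>Deductions are trees. Assumption classes are de Bruijn indices: a leaf \<open>Asm i \<alpha>\<close> that lies
  in the scope of \<open>k\<close> discharges belongs to the \<open>i\<close>-th innermost of them if \<open>i < k\<close>, and is an open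
  assumption otherwise.\<close>

datatype 'v ded =
    Asm nat "'v fm"
  | Infer "'v rule" "'v ded list"

fun concl :: "'v ded \<Rightarrow> 'v fm" where
  "concl (Asm i \<alpha>) = \<alpha>"
| "concl (Infer r Ds) = rule_concl r"

definition discharges :: "'v rule \<Rightarrow> nat \<Rightarrow> nat" where
  "discharges r i = length (fst (prems r ! i))"

lemma size_ded_nth [termination_simp]:
  fixes Ds :: "'v ded list"
  assumes "i < length Ds"
  shows "size (Ds ! i) < Suc (size r + size_list size Ds)"
proof -
  have "size (Ds ! i) \<le> size_list size Ds"
    using assms by (intro size_list_estimation'[of "Ds ! i"]) auto
  then show ?thesis by simp
qed

text \<open>\<open>\<Gamma>\<close> lists the assumptions dischargeable at the root, innermost first.\<close>

fun deduction_in :: "'v fm list \<Rightarrow> 'v ded \<Rightarrow> bool" where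
  "deduction_in \<Gamma> (Asm i \<alpha>) \<longleftrightarrow> (i < length \<Gamma> \<longrightarrow> \<alpha> = \<Gamma> ! i)"
| "deduction_in \<Gamma> (Infer r Ds) \<longleftrightarrow>
     length Ds = length (prems r) \<and>
     (\<forall>i \<in> {..<length Ds}. concl (Ds ! i) = snd (prems r ! i) \<and>
        deduction_in (fst (prems r ! i) @ \<Gamma>) (Ds ! i))"

abbreviation deduction :: "'v ded \<Rightarrow> bool" where
  "deduction \<equiv> deduction_in []"

fun open_above :: "nat \<Rightarrow> 'v ded \<Rightarrow> 'v fm set" where
  "open_above k (Asm i \<alpha>) = (if k \<le> i then {\<alpha>} else {})"
| "open_above k (Infer r Ds) = (\<Union>i \<in> {..<length Ds}. open_above (k + discharges r i) (Ds ! i))"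

abbreviation open_assms :: "'v ded \<Rightarrow> 'v fm set" where
  "open_assms \<equiv> open_above 0"

text \<open>Formula occurrences are addressed by paths from the root: the \<open>i\<close>-th premise of the
  inference whose conclusion is at \<open>p\<close> is at \<open>p @ [i]\<close>.\<close>

fun subded :: "'v ded \<Rightarrow> nat list \<Rightarrow> 'v ded option" where
  "subded D [] = Some D"
| "subded (Asm i \<alpha>) (j # p) = None"
| "subded (Infer r Ds) (j # p) = (if j < length Ds then subded (Ds ! j) p else None)"

definition fm_at :: "'v ded \<Rightarrow> nat list \<Rightarrow> 'v fm option" where
  "fm_at D p = map_option concl (subded D p)"

definition concl_of_rule :: "'v ded \<Rightarrow> nat list \<Rightarrow> 'v rule \<Rightarrow> bool" where
  "concl_of_rule D p r \<longleftrightarrow> (\<exists>Ds. subded D p = Some (Infer r Ds))"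

definition del_minor :: "'v ded \<Rightarrow> nat list \<Rightarrow> nat list \<Rightarrow> bool" where
  "del_minor D q p \<longleftrightarrow>
     (\<exists>r i. concl_of_rule D p r \<and> is_del_rule r \<and> 0 < i \<and> q = p @ [i] \<and> fm_at D q \<noteq> None)"

definition E_major :: "'v ded \<Rightarrow> nat list \<Rightarrow> bool" where
  "E_major D q \<longleftrightarrow>
     (\<exists>p r. concl_of_rule D p r \<and> is_E_rule r \<and> q = p @ [0] \<and> fm_at D q \<noteq> None)"

definition segment :: "'v ded \<Rightarrow> nat list list \<Rightarrow> bool" where
  "segment D ps \<longleftrightarrow>
     ps \<noteq> [] \<and>
     (\<exists>\<alpha>. \<forall>p \<in> set ps. fm_at D p = Some \<alpha>) \<and>
     (\<forall>i. Suc i < length ps \<longrightarrow> del_minor D (ps ! i) (ps ! Suc i)) \<and>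
     (\<nexists>p. del_minor D (last ps) p) \<and>
     (\<nexists>r. concl_of_rule D (hd ps) r \<and> is_del_rule r)"

definition cut :: "'v ded \<Rightarrow> nat list list \<Rightarrow> bool" where
  "cut D ps \<longleftrightarrow>
     segment D ps \<and> E_major D (last ps) \<and>
     (length ps > 1 \<or> length ps = 1 \<and> (\<exists>r. concl_of_rule D (hd ps) r \<and> is_I_rule r))"

definition normal :: "'v ded \<Rightarrow> bool" where
  "normal D \<longleftrightarrow> (\<nexists>ps. cut D ps)"

definition atomic_BotE :: "'v ded \<Rightarrow> bool" where
  "atomic_BotE D \<longleftrightarrow>
     (\<forall>p \<chi>. concl_of_rule D p (BotE \<chi>) \<longrightarrow> (\<exists>v. \<chi> = Var v \<or> \<chi> = Neg (Var v)))"

fun lift :: "nat \<Rightarrow> 'v ded \<Rightarrow> 'v ded" where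
  "lift k (Asm i \<alpha>) = Asm (if i < k then i else Suc i) \<alpha>"
| "lift k (Infer r Ds) =
     Infer r (map (\<lambda>i. lift (k + discharges r i) (Ds ! i)) [0..<length Ds])"

text \<open>\<open>subst k S D\<close> puts \<open>S\<close> in place of every assumption of \<open>D\<close> in the class \<open>k\<close>, which disappears.\<close>

fun subst :: "nat \<Rightarrow> 'v ded \<Rightarrow> 'v ded \<Rightarrow> 'v ded" where
  "subst k S (Asm i \<alpha>) = (if i < k then Asm i \<alpha> else if i = k then S else Asm (i - 1) \<alpha>)"
| "subst k S (Infer r Ds) =
     Infer r (map (\<lambda>i. subst (k + discharges r i) ((lift 0 ^^ discharges r i) S) (Ds ! i))
       [0..<length Ds])"

inductive detour :: "'v ded \<Rightarrow> 'v ded \<Rightarrow> bool" where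
  "detour (Infer (AndE1 \<phi> \<psi>) [Infer (AndI \<phi> \<psi>) [D1, D2]]) D1"
| "detour (Infer (AndE2 \<phi> \<psi>) [Infer (AndI \<phi> \<psi>) [D1, D2]]) D2"
| "detour (Infer (NegAndE \<phi> \<psi> \<chi>) [Infer (NegAndI1 \<phi> \<psi>) [D], E1, E2]) (subst 0 D E1)"
| "detour (Infer (NegAndE \<phi> \<psi> \<chi>) [Infer (NegAndI2 \<phi> \<psi>) [D], E1, E2]) (subst 0 D E2)"
| "detour (Infer (OrE \<phi> \<psi> \<chi>) [Infer (OrI1 \<phi> \<psi>) [D], E1, E2]) (subst 0 D E1)"
| "detour (Infer (OrE \<phi> \<psi> \<chi>) [Infer (OrI2 \<phi> \<psi>) [D], E1, E2]) (subst 0 D E2)"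
| "detour (Infer (NegOrE1 \<phi> \<psi>) [Infer (NegOrI \<phi> \<psi>) [D1, D2]]) D1"
| "detour (Infer (NegOrE2 \<phi> \<psi>) [Infer (NegOrI \<phi> \<psi>) [D1, D2]]) D2"
| "detour (Infer (NegNegE \<phi>) [Infer (NegNegI \<phi>) [D]]) D"
| "detour (Infer (BoxE \<phi>) [Infer (BoxI \<phi>) [D, E]]) D"
| "detour (Infer (NegBoxE \<phi>) [Infer (NegBoxI \<phi>) [D], E]) D"

text \<open>When an E-rule \<open>e\<close> is permuted over a del-rule, its minor deductions \<open>Es\<close> move under one more
  discharge, hence the lifting; the assumptions discharged by \<open>e\<close> itself are left alone.\<close>

definition lift_minors :: "'v rule \<Rightarrow> 'v ded list \<Rightarrow> 'v ded list" where
  "lift_minors e Es = map (\<lambda>i. lift (discharges e (Suc i)) (Es ! i)) [0..<length Es]"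

inductive permutation :: "'v ded \<Rightarrow> 'v ded \<Rightarrow> bool" where
  "is_E_rule e \<Longrightarrow>
     permutation (Infer e (Infer (OrE \<phi> \<psi> \<chi>) [M, D1, D2] # Es))
       (Infer (OrE \<phi> \<psi> (rule_concl e))
         [M, Infer e (D1 # lift_minors e Es), Infer e (D2 # lift_minors e Es)])"
| "is_E_rule e \<Longrightarrow>
     permutation (Infer e (Infer (NegAndE \<phi> \<psi> \<chi>) [M, D1, D2] # Es))
       (Infer (NegAndE \<phi> \<psi> (rule_concl e))
         [M, Infer e (D1 # lift_minors e Es), Infer e (D2 # lift_minors e Es)])"

inductive converts :: "'v ded \<Rightarrow> 'v ded \<Rightarrow> bool" where
  "detour D D' \<Longrightarrow> converts D D'"
| "permutation D D' \<Longrightarrow> converts D D'"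
| "i < length Ds \<Longrightarrow> converts (Ds ! i) D' \<Longrightarrow> converts (Infer r Ds) (Infer r (Ds[i := D']))"

abbreviation reduces :: "'v ded \<Rightarrow> 'v ded \<Rightarrow> bool" where
  "reduces \<equiv> converts\<^sup>*\<^sup>*"

end

theory Submission
  imports Defs
begin

text \<open>Call a deduction cut-headed if it ends in an I-rule or a del-rule; normality follows if no
  major premise of an E-rule is cut-headed. Normal deductions are closed, up to reduction, under
  E-rules and under substitution for an assumption, by simultaneous induction on the size of the
  major premise, respectively of the assumption. A detour conversion only substitutes for formulas
  smaller than the major premise. Conversely, substituting for an assumption of size \<open>n\<close> can make a
  major premise cut-headed only along a chain of E-rules starting at that assumption, and such
  chains shrink formulas, so every cut created has size at most \<open>n\<close>.\<close>

section \<open>Local cut-freeness and normality\<close>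

fun cut_headed :: "'v ded \<Rightarrow> bool" where
  "cut_headed (Asm i \<alpha>) \<longleftrightarrow> False"
| "cut_headed (Infer r Ds) \<longleftrightarrow> is_I_rule r \<or> is_del_rule r"

text \<open>A recursive condition on single inferences in place of one on segments. The guard
  \<open>Ds \<noteq> []\<close> keeps \<open>Ds ! 0\<close> meaningful on trees that need not be
  deductions.\<close>

fun cut_free :: "'v ded \<Rightarrow> bool" where
  "cut_free (Asm i \<alpha>) \<longleftrightarrow> True"
| "cut_free (Infer r Ds) \<longleftrightarrow>
     (\<forall>D \<in> set Ds. cut_free D) \<and> (is_E_rule r \<longrightarrow> Ds \<noteq> [] \<longrightarrow> \<not> cut_headed (Ds ! 0))"

lemma cut_free_subded: "subded D p = Some D' \<Longrightarrow> cut_free D \<Longrightarrow> cut_free D'"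
  by (induction D p rule: subded.induct) (auto split: if_splits)

lemma subded_append: "subded D p = Some D' \<Longrightarrow> subded D (p @ q) = subded D' q"
  by (induction D p rule: subded.induct) (auto split: if_splits)

text \<open>The last occurrence of a cut is the major premise of an E-rule. It is concluded by a
  del-rule if the segment is longer than one, and by an I-rule otherwise, hence it is
  cut-headed.\<close>

lemma cut_free_imp_normal:
  assumes "cut_free D"
  shows "normal D"
  unfolding normal_def
proof
  assume "\<exists>ps. cut D ps"
  then obtain ps where ps: "segment D ps" "E_major D (last ps)"
    and len: "length ps > 1 \<or> length ps = 1 \<and> (\<exists>r. concl_of_rule D (hd ps) r \<and> is_I_rule r)"
    unfolding cut_def by blast
  obtain p e Ds where e: "subded D p = Some (Infer e Ds)" "is_E_rule e" "last ps = p @ [0]"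
    "fm_at D (last ps) \<noteq> None"
    using ps(2) unfolding E_major_def concl_of_rule_def by blast
  have "\<exists>r. concl_of_rule D (last ps) r \<and> (is_I_rule r \<or> is_del_rule r)"
  proof (cases "length ps > 1")
    case True
    then have "Suc (length ps - 2) < length ps" "Suc (length ps - 2) = length ps - 1" by auto
    then have "del_minor D (ps ! (length ps - 2)) (ps ! (length ps - 1))"
      using ps(1) unfolding segment_def by metis
    moreover have "ps \<noteq> []" using True by auto
    ultimately show ?thesis
      by (auto simp: del_minor_def last_conv_nth)
  next
    case False
    then have "length ps = 1" using len by blast
    then have "hd ps = last ps" by (cases ps) auto
    then show ?thesis using len False by auto
  qed
  then obtain r Es where r: "subded D (last ps) = Some (Infer r Es)" "is_I_rule r \<or> is_del_rule r"
    unfolding concl_of_rule_def by blast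
  moreover have "subded D (last ps) = (if Ds = [] then None else Some (Ds ! 0))"
    using e subded_append[OF e(1), of "[0]"] by auto
  ultimately have "Ds \<noteq> []" "cut_headed (Ds ! 0)" by (auto split: if_splits)
  then show False using cut_free_subded[OF e(1) assms] e(2) by simp
qed

section \<open>Weakening and substitution of deductions\<close>

lemma concl_lift [simp]: "concl (lift k D) = concl D"
  by (cases D) auto

lemma cut_headed_lift [simp]: "cut_headed (lift k D) \<longleftrightarrow> cut_headed D"
  by (cases D) auto

lemma cut_free_lift: "cut_free D \<Longrightarrow> cut_free (lift k D)"
  by (induction D arbitrary: k) auto

lemma concl_lift_funpow [simp]: "concl ((lift k ^^ n) D) = concl D"
  by (induction n) auto

lemma cut_free_lift_funpow: "cut_free D \<Longrightarrow> cut_free ((lift k ^^ n) D)"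
  by (induction n) (auto intro: cut_free_lift)

text \<open>Premises are matched as a list instead of by index, so that for a concrete rule the
  simplifier unfolds them one by one.\<close>

lemma deduction_in_Infer:
  "deduction_in \<Gamma> (Infer r Ds) \<longleftrightarrow>
     list_all2 (\<lambda>p D. concl D = snd p \<and> deduction_in (fst p @ \<Gamma>) D) (prems r) Ds"
  by (auto simp: list_all2_conv_all_nth)

text \<open>Weakening. The new class goes behind \<open>\<Gamma>1\<close> rather than to the front
  because the induction passes under discharges.\<close>

lemma deduction_in_lift:
  "deduction_in (\<Gamma>1 @ \<Gamma>2) D \<Longrightarrow> deduction_in (\<Gamma>1 @ \<alpha> # \<Gamma>2) (lift (length \<Gamma>1) D)"
proof (induction D arbitrary: \<Gamma>1)
  case (Asm i \<beta>)
  then show ?case by (auto simp: nth_append Suc_diff_le)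
next
  case (Infer r Ds)
  have "deduction_in (fst (prems r ! i) @ \<Gamma>1 @ \<alpha> # \<Gamma>2)
      (lift (length \<Gamma>1 + discharges r i) (Ds ! i))" if "i < length Ds" for i
    using Infer.IH[of "Ds ! i" "fst (prems r ! i) @ \<Gamma>1"] Infer.prems that
    by (simp add: discharges_def add.commute)
  then show ?case using Infer.prems by simp
qed

lemma deduction_in_lift_funpow:
  "deduction_in \<Gamma> D \<Longrightarrow> deduction_in (\<Delta> @ \<Gamma>) ((lift 0 ^^ length \<Delta>) D)"
  using deduction_in_lift[of "[]"] by (induction \<Delta>) auto

text \<open>The conclusion could change only if \<open>D\<close> is itself a leaf of the replaced
  class, and well-formedness makes such a leaf carry \<open>concl S\<close>.\<close>

lemma concl_subst:
  assumes "deduction_in (\<Gamma>1 @ concl S # \<Gamma>2) D"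
  shows "concl (subst (length \<Gamma>1) S D) = concl D"
  using assms by (cases D) auto

text \<open>Passing under a rule that discharges \<Delta> puts \<Delta> in front of
  \<open>\<Gamma>1\<close> and weakens \<open>S\<close> by \<Delta>, so the induction generalizes
  both.\<close>

lemma deduction_in_subst:
  "deduction_in (\<Gamma>1 @ concl S # \<Gamma>2) D \<Longrightarrow> deduction_in (\<Gamma>1 @ \<Gamma>2) S \<Longrightarrow>
     deduction_in (\<Gamma>1 @ \<Gamma>2) (subst (length \<Gamma>1) S D)"
proof (induction D arbitrary: \<Gamma>1 S)
  case (Asm i \<beta>)
  then show ?case
    by (cases "i \<le> length \<Gamma>1") (auto simp: nth_append nth_Cons')
next
  case (Infer r Ds)
  have "concl (subst (length \<Gamma>1 + discharges r i) ((lift 0 ^^ discharges r i) S) (Ds ! i)) =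
        snd (prems r ! i) \<and>
      deduction_in (fst (prems r ! i) @ \<Gamma>1 @ \<Gamma>2)
        (subst (length \<Gamma>1 + discharges r i) ((lift 0 ^^ discharges r i) S) (Ds ! i))"
    if i: "i < length Ds" for i
  proof -
    let ?\<Delta> = "fst (prems r ! i)" and ?S = "(lift 0 ^^ discharges r i) S"
    have "deduction_in ((?\<Delta> @ \<Gamma>1) @ concl ?S # \<Gamma>2) (Ds ! i)"
      using Infer.prems(1) i by simp
    moreover have "deduction_in ((?\<Delta> @ \<Gamma>1) @ \<Gamma>2) ?S"
      using deduction_in_lift_funpow[OF Infer.prems(2), of ?\<Delta>] by (simp add: discharges_def)
    ultimately show ?thesis
      using Infer.IH[of "Ds ! i" "?\<Delta> @ \<Gamma>1" ?S] concl_subst[of "?\<Delta> @ \<Gamma>1" ?S \<Gamma>2 "Ds ! i"]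
        Infer.prems(1) i
      by (simp add: discharges_def add.commute)
  qed
  then show ?case using Infer.prems by simp
qed

text \<open>Leaves counted at threshold \<open>j\<close> have index at least \<open>k\<close>, so
  they move up by one together with the threshold.\<close>

lemma open_above_lift: "k \<le> j \<Longrightarrow> open_above (Suc j) (lift k D) = open_above j D"
  by (induction D arbitrary: k j) auto

lemma open_above_lift_funpow: "open_above (j + n) ((lift 0 ^^ n) D) = open_above j D"
  by (induction n) (auto simp: open_above_lift)

text \<open>Removing class \<open>k\<close> lowers all larger indices by one, which accounts for the
  threshold \<open>Suc j\<close> on \<open>D\<close>.\<close>

lemma open_above_subst:
  "k \<le> j \<Longrightarrow> open_above j (subst k S D) \<subseteq> open_above (Suc j) D \<union> open_above j S"
proof (induction D arbitrary: k j S)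
  case (Infer r Ds)
  have "open_above (j + discharges r i)
        (subst (k + discharges r i) ((lift 0 ^^ discharges r i) S) (Ds ! i))
      \<subseteq> open_above (Suc j + discharges r i) (Ds ! i) \<union> open_above j S" if "i < length Ds" for i
    using Infer.IH[of "Ds ! i" "k + discharges r i" "j + discharges r i"
        "(lift 0 ^^ discharges r i) S"] Infer.prems that
    by (simp add: open_above_lift_funpow)
  then show ?case by fastforce
qed auto

section \<open>Preservation under conversions, and reduction inside inferences\<close>

lemma detour_preserves:
  assumes "detour D D'" "deduction_in \<Gamma> D"
  shows "deduction_in \<Gamma> D' \<and> concl D' = concl D \<and> open_above k D' \<subseteq> open_above k D"
proof -
  have *: "deduction_in \<Gamma> (subst 0 S E) \<and> concl (subst 0 S E) = concl E \<and>
      open_above k (subst 0 S E) \<subseteq> open_above (Suc k) E \<union> open_above k S"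
    if "deduction_in (concl S # \<Gamma>) E" "deduction_in \<Gamma> S" for S E
    using that deduction_in_subst[of "[]" S \<Gamma> E] concl_subst[of "[]" S \<Gamma> E]
      open_above_subst[of 0 k S E] by simp
  note simps = deduction_in_Infer discharges_def lessThan_Suc
  show ?thesis
    using assms(1)
  proof (cases rule: detour.cases)
    \<comment> \<open>Conversions 3 to 6, where the E-rule is a del-rule, substitute; all others
      return the deduction of a premise of the I-rule.\<close>
    case (3 \<phi> \<psi> \<chi> S E1 E2)
    then show ?thesis using assms(2) *[of S E1] by (auto simp: simps simp del: deduction_in.simps(2))
  next
    case (4 \<phi> \<psi> \<chi> S E1 E2)
    then show ?thesis using assms(2) *[of S E2] by (auto simp: simps simp del: deduction_in.simps(2))
  next
    case (5 \<phi> \<psi> \<chi> S E1 E2)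
    then show ?thesis using assms(2) *[of S E1] by (auto simp: simps simp del: deduction_in.simps(2))
  next
    case (6 \<phi> \<psi> \<chi> S E1 E2)
    then show ?thesis using assms(2) *[of S E2] by (auto simp: simps simp del: deduction_in.simps(2))
  qed (use assms(2) in \<open>auto simp: simps simp del: deduction_in.simps(2)\<close>)
qed

text \<open>Permuting \<open>e\<close> upward puts it under a discharge of \<open>\<alpha>\<close>.
  Each minor deduction is weakened by \<open>\<alpha>\<close>, placed behind the assumptions that
  \<open>e\<close> itself discharges there.\<close>

lemma deduction_in_lift_minors:
  assumes "deduction_in \<Gamma> (Infer e (M # Es))" "deduction_in (\<alpha> # \<Gamma>) D" "concl D = concl M"
  shows "deduction_in (\<alpha> # \<Gamma>) (Infer e (D # lift_minors e Es))"
proof -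
  have "concl ((D # lift_minors e Es) ! i) = snd (prems e ! i) \<and>
      deduction_in (fst (prems e ! i) @ \<alpha> # \<Gamma>) ((D # lift_minors e Es) ! i)"
    if "i < Suc (length Es)" for i
  proof (cases i)
    case 0
    \<comment> \<open>No rule discharges at its first premise; \<open>MA\<close>, having no
      premises, is excluded by the length condition.\<close>
    have "fst (prems e ! 0) = []" by (cases e) (use assms in auto)
    then show ?thesis using 0 assms by force
  next
    case (Suc j)
    have "concl (Es ! j) = snd (prems e ! i) \<and> deduction_in (fst (prems e ! i) @ \<Gamma>) (Es ! j)"
      using assms(1) that Suc by force
    then show ?thesis
      using that Suc deduction_in_lift[of "fst (prems e ! i)" \<Gamma> "Es ! j" \<alpha>]
      by (simp add: lift_minors_def discharges_def)
  qed
  then show ?thesis using assms(1) by (simp add: lift_minors_def)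
qed

text \<open>The extra discharge raises the threshold by one and the lifting raises the open indices
  by one; the two effects cancel.\<close>

lemma open_above_lift_minors:
  assumes "open_above (Suc k) D \<subseteq> A" "open_above k (Infer e (M # Es)) \<subseteq> A"
    "discharges e 0 = 0"
  shows "open_above (Suc k) (Infer e (D # lift_minors e Es)) \<subseteq> A"
proof -
  have "open_above (Suc k + discharges e i) ((D # lift_minors e Es) ! i) \<subseteq> A"
    if "i < Suc (length Es)" for i
  proof (cases i)
    case 0
    then show ?thesis using assms by simp
  next
    case (Suc j)
    have "open_above (k + discharges e i) ((M # Es) ! i) \<subseteq> A"
      using assms(2) that by fastforce
    then show ?thesis
      using that Suc open_above_lift[of "discharges e i" "k + discharges e i" "Es ! j"]
      by (simp add: lift_minors_def)
  qed
  then show ?thesis by (auto simp: lift_minors_def)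
qed

lemma E_rule_major:
  assumes "is_E_rule e"
  shows "discharges e 0 = 0" "fst (prems e ! 0) = []" "prems e \<noteq> []"
  using assms by (cases e; simp add: discharges_def)+

text \<open>Both del-rules have premises of this shape, so one argument serves both permutations;
  \<open>d'\<close> stands for \<open>d\<close> with its conclusion changed to that of
  \<open>e\<close>.\<close>

lemma permute_preserves:
  assumes e: "is_E_rule e" and ded: "deduction_in \<Gamma> (Infer e (Infer d [M, D1, D2] # Es))"
    and d: "prems d = [([], \<mu>), ([\<alpha>], rule_concl d), ([\<beta>], rule_concl d)]"
    and d': "prems d' = [([], \<mu>), ([\<alpha>], rule_concl e), ([\<beta>], rule_concl e)]"
  defines "D' \<equiv> Infer d' [M, Infer e (D1 # lift_minors e Es), Infer e (D2 # lift_minors e Es)]"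
  shows "deduction_in \<Gamma> D' \<and>
    open_above k D' \<subseteq> open_above k (Infer e (Infer d [M, D1, D2] # Es))"
proof
  let ?M = "Infer d [M, D1, D2]"
  let ?A = "open_above k (Infer e (?M # Es))"
  have "deduction_in \<Gamma> ?M"
    using ded E_rule_major[OF e] by force
  then have M: "deduction_in \<Gamma> M" "concl M = \<mu>" "deduction_in (\<alpha> # \<Gamma>) D1"
    "deduction_in (\<beta> # \<Gamma>) D2" "concl D1 = concl ?M" "concl D2 = concl ?M"
    using d by (auto simp: deduction_in_Infer simp del: deduction_in.simps(2))
  then show "deduction_in \<Gamma> D'"
    using d' deduction_in_lift_minors[OF ded]
    by (simp add: D'_def deduction_in_Infer del: deduction_in.simps(2))
  \<comment> \<open>\<open>e\<close> discharges nothing at its major premise, so the threshold there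
    is still \<open>k\<close>.\<close>
  have "open_above k ?M \<subseteq> ?A"
    using UN_upper[of 0 "{..<Suc (length Es)}"
        "\<lambda>i. open_above (k + discharges e i) ((?M # Es) ! i)"] E_rule_major(1)[OF e]
    by (simp del: open_above.simps(2)) simp
  moreover have "open_above k ?M = open_above k M \<union> open_above (Suc k) D1 \<union> open_above (Suc k) D2"
    using d by (auto simp: discharges_def lessThan_Suc)
  ultimately have A: "open_above k M \<subseteq> ?A" "open_above (Suc k) D1 \<subseteq> ?A"
    "open_above (Suc k) D2 \<subseteq> ?A"
    by blast+
  have "open_above k D' = open_above k M \<union>
      open_above (Suc k) (Infer e (D1 # lift_minors e Es)) \<union>
      open_above (Suc k) (Infer e (D2 # lift_minors e Es))"
    unfolding D'_def open_above.simps(2)[of k d'] using d'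
    by (auto simp: discharges_def lessThan_Suc simp del: open_above.simps(2))
  then show "open_above k D' \<subseteq> ?A"
    using A open_above_lift_minors[OF _ order_refl E_rule_major(1)[OF e]] by (metis Un_least)
qed

lemma permutation_preserves:
  assumes "permutation D D'" "deduction_in \<Gamma> D"
  shows "deduction_in \<Gamma> D' \<and> concl D' = concl D \<and> open_above k D' \<subseteq> open_above k D"
  using assms
proof (cases rule: permutation.cases)
  case (1 e \<phi> \<psi> \<chi> M D1 D2 Es)
  then show ?thesis
    using permute_preserves[of e \<Gamma> "OrE \<phi> \<psi> \<chi>" M D1 D2 Es "Or \<phi> \<psi>" \<phi> \<psi>
        "OrE \<phi> \<psi> (rule_concl e)" k] assms(2)
    by (simp del: deduction_in.simps(2) open_above.simps(2))
next
  case (2 e \<phi> \<psi> \<chi> M D1 D2 Es)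
  then show ?thesis
    using permute_preserves[of e \<Gamma> "NegAndE \<phi> \<psi> \<chi>" M D1 D2 Es "Neg (And \<phi> \<psi>)" "Neg \<phi>" "Neg \<psi>"
        "NegAndE \<phi> \<psi> (rule_concl e)" k] assms(2)
    by (simp del: deduction_in.simps(2) open_above.simps(2))
qed

text \<open>A conversion inside a premise takes place under the discharges of the rule, so
  \<open>\<Gamma>\<close> and \<open>k\<close> vary in the induction.\<close>

lemma converts_preserves:
  "converts D D' \<Longrightarrow> deduction_in \<Gamma> D \<Longrightarrow>
     deduction_in \<Gamma> D' \<and> concl D' = concl D \<and> open_above k D' \<subseteq> open_above k D"
proof (induction arbitrary: \<Gamma> k rule: converts.induct)
  case (3 i Ds D' r)
  have IH: "deduction_in (fst (prems r ! i) @ \<Gamma>) D' \<and> concl D' = concl (Ds ! i) \<and>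
      open_above (k + discharges r i) D' \<subseteq> open_above (k + discharges r i) (Ds ! i)"
    using 3 by (metis deduction_in.simps(2) lessThan_iff)
  have "deduction_in \<Gamma> (Infer r (Ds[i := D']))"
    using 3 IH by (auto simp: nth_list_update)
  moreover have "open_above k (Infer r (Ds[i := D'])) \<subseteq> open_above k (Infer r Ds)"
    unfolding open_above.simps length_list_update
    using IH 3(1) by (intro UN_mono subset_refl) (auto simp: nth_list_update)
  ultimately show ?case by simp
qed (use detour_preserves permutation_preserves in blast)+

lemma reduces_preserves:
  "reduces D D' \<Longrightarrow> deduction_in \<Gamma> D \<Longrightarrow>
     deduction_in \<Gamma> D' \<and> concl D' = concl D \<and> open_above k D' \<subseteq> open_above k D"
proof (induction rule: rtranclp_induct)
  case (step D1 D2)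
  then show ?case using converts_preserves[OF step(2), of \<Gamma> k] by auto
qed simp

lemma reduces_Infer_nth:
  "reduces D D' \<Longrightarrow> i < length Ds \<Longrightarrow> reduces (Infer r (Ds[i := D])) (Infer r (Ds[i := D']))"
proof (induction rule: rtranclp_induct)
  case (step D1 D2)
  have "converts (Infer r (Ds[i := D1])) (Infer r (Ds[i := D1, i := D2]))"
    using step by (intro converts.intros(3)) auto
  then show ?case using step by (simp add: rtranclp.rtrancl_into_rtrancl)
qed simp

lemma reduces_Infer:
  assumes "list_all2 reduces Ds Ds'"
  shows "reduces (Infer r Ds) (Infer r Ds')"
proof -
  \<comment> \<open>The premises are reduced from left to right; \<open>Es\<close> is the part
    already done.\<close>
  have "reduces (Infer r (Es @ Ds)) (Infer r (Es @ Ds'))" for Es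
    using assms
  proof (induction arbitrary: Es rule: list_all2_induct)
    case (Cons D Ds D' Ds')
    have "reduces (Infer r (Es @ D # Ds)) (Infer r (Es @ D' # Ds))"
      using reduces_Infer_nth[OF Cons(1), of "length Es" "Es @ D # Ds" r] by simp
    also have "reduces \<dots> (Infer r (Es @ D' # Ds'))"
      using Cons.IH[of "Es @ [D']"] by simp
    finally show ?case .
  qed simp
  from this[of "[]"] show ?thesis by simp
qed

section \<open>Simultaneous induction for eliminations and substitutions\<close>

text \<open>This is why chains of E-rules shrink. Sizes are compared because a conclusion such as
  the \<open>Neg \<phi>\<close> of \<open>NegOrE1\<close> is not a subformula of the major premise;
  del-rules have an arbitrary conclusion.\<close>

lemma size_concl_less_major:
  "is_E_rule e \<Longrightarrow> \<not> is_del_rule e \<Longrightarrow> size (rule_concl e) < size (snd (prems e ! 0))"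
  by (cases e) auto

definition normalizable :: "'v ded \<Rightarrow> bool" where
  "normalizable D \<longleftrightarrow> (\<exists>D'. reduces D D' \<and> cut_free D')"

lemma normalizable_converts: "converts D D' \<Longrightarrow> normalizable D' \<Longrightarrow> normalizable D"
  unfolding normalizable_def by (meson converse_rtranclp_into_rtranclp)

lemma normalizable_reduces: "reduces D D' \<Longrightarrow> normalizable D' \<Longrightarrow> normalizable D"
  unfolding normalizable_def by (meson rtranclp_trans)

lemma cut_free_normalizable: "cut_free D \<Longrightarrow> normalizable D"
  unfolding normalizable_def by blast

text \<open>All premises are cut-free, so only the last inference can violate cut-freeness. The
  \<open>itself\<close> argument fixes \<open>'v\<close>, which the type of \<open>n\<close> does
  not mention.\<close>

definition elims_normalizable :: "'v itself \<Rightarrow> nat \<Rightarrow> bool" where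
  "elims_normalizable _ n \<longleftrightarrow>
     (\<forall>\<Gamma> e M (Es :: 'v ded list). is_E_rule e \<longrightarrow> deduction_in \<Gamma> (Infer e (M # Es)) \<longrightarrow>
        size (concl M) \<le> n \<longrightarrow> (\<forall>D \<in> set (M # Es). cut_free D) \<longrightarrow>
        normalizable (Infer e (M # Es)))"

definition substs_normalizable :: "'v itself \<Rightarrow> nat \<Rightarrow> bool" where
  "substs_normalizable _ n \<longleftrightarrow>
     (\<forall>\<Gamma>1 \<Gamma>2 (S :: 'v ded) D. deduction_in (\<Gamma>1 @ concl S # \<Gamma>2) D \<longrightarrow>
        deduction_in (\<Gamma>1 @ \<Gamma>2) S \<longrightarrow> size (concl S) \<le> n \<longrightarrow> cut_free S \<longrightarrow> cut_free D \<longrightarrow>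
        normalizable (subst (length \<Gamma>1) S D))"

text \<open>An assumption discharged by a del-rule is smaller than the major premise, so hypothesis
  \<open>S\<close> need only cover smaller formulas.\<close>

lemma detour_normalizable:
  assumes "is_E_rule e" "is_I_rule r" "deduction_in \<Gamma> (Infer e (Infer r Ms # Es))"
    "\<forall>D \<in> set (Ms @ Es). cut_free D"
    and S: "\<And>S D. deduction_in (concl S # \<Gamma>) D \<Longrightarrow> deduction_in \<Gamma> S \<Longrightarrow>
      size (concl S) < size (rule_concl r) \<Longrightarrow> cut_free S \<Longrightarrow> cut_free D \<Longrightarrow>
      normalizable (subst 0 S D)"
  shows "normalizable (Infer e (Infer r Ms # Es))"
proof -
  have "\<exists>D'. detour (Infer e (Infer r Ms # Es)) D' \<and> normalizable D'"
    using assms(1-4)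
    \<comment> \<open>Pairs in which \<open>r\<close> does not conclude the major premise of
      \<open>e\<close> contradict well-formedness; every remaining pair has a detour
      conversion.\<close>
    by (cases e; cases r; force simp: deduction_in_Infer list_all2_Cons1
        intro: detour.intros cut_free_normalizable S simp del: deduction_in.simps(2))
  then show ?thesis using normalizable_converts converts.intros(1) by blast
qed

text \<open>By induction on the major deduction \<open>M\<close>. An I-rule at its root gives a
  detour, which needs only smaller substitutions. A del-rule is permuted below \<open>e\<close>,
  which then acts on the minor deductions of that rule: the same formula, but smaller
  deductions.\<close>

lemma elims_normalizable_step:
  assumes "\<And>m. m < n \<Longrightarrow> substs_normalizable TYPE('v) m"
  shows "elims_normalizable TYPE('v) n"
proof -
  have "normalizable (Infer e (M # Es))"
    if "is_E_rule e" "deduction_in \<Gamma> (Infer e (M # Es))"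
      "size (concl M) \<le> n" "\<forall>D \<in> set (M # Es). cut_free D" for \<Gamma> e and M :: "'v ded" and Es
    using that
  \<comment> \<open>After a permutation \<open>Es\<close> is lifted and one more assumption is
    dischargeable.\<close>
  proof (induction M arbitrary: \<Gamma> Es)
    case (Asm i \<alpha>)
    then show ?case by (intro cut_free_normalizable) auto
  next
    case (Infer r Ms)
    consider (neutral) "\<not> is_I_rule r" "\<not> is_del_rule r" | (I) "is_I_rule r" | (del) "is_del_rule r"
      by blast
    then show ?case
    proof cases
      case neutral
      then show ?thesis using Infer.prems by (intro cut_free_normalizable) auto
    next
      case I
      show ?thesis
      proof (rule detour_normalizable[OF Infer.prems(1) I Infer.prems(2)])
        show "normalizable (subst 0 S D)"
          if "deduction_in (concl S # \<Gamma>) D" "deduction_in \<Gamma> S"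
            "size (concl S) < size (rule_concl r)" "cut_free S" "cut_free D" for S D
        proof -
          have "substs_normalizable TYPE('v) (size (concl S))"
            using assms that(3) Infer.prems(3) by simp
          then show ?thesis
            using that unfolding substs_normalizable_def
            by (metis append_Nil le_refl list.size(3))
        qed
      qed (use Infer.prems in auto)
    next
      case del
      have r: "deduction_in \<Gamma> (Infer r Ms)" "rule_concl r = snd (prems e ! 0)"
        using Infer.prems(2) E_rule_major[OF Infer.prems(1)] by force+
      have minors: "normalizable (Infer e (D # lift_minors e Es))"
        if "D \<in> set Ms" "deduction_in (\<alpha> # \<Gamma>) D" "concl D = rule_concl r" for D \<alpha>
      proof (rule Infer.IH[OF that(1) Infer.prems(1)])
        show "deduction_in (\<alpha> # \<Gamma>) (Infer e (D # lift_minors e Es))"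
          using deduction_in_lift_minors[OF Infer.prems(2) that(2)] that(3) by simp
        show "size (concl D) \<le> n" using Infer.prems(3) that(3) by simp
        show "\<forall>D' \<in> set (D # lift_minors e Es). cut_free D'"
          using Infer.prems(4) that(1) by (auto simp: lift_minors_def intro: cut_free_lift)
      qed
      obtain M D1 D2 d where Ms: "Ms = [M, D1, D2]"
        and d: "is_del_rule d" "is_E_rule d"
          "permutation (Infer e (Infer r Ms # Es))
             (Infer d [M, Infer e (D1 # lift_minors e Es), Infer e (D2 # lift_minors e Es)])"
        and D12: "normalizable (Infer e (D1 # lift_minors e Es))"
          "normalizable (Infer e (D2 # lift_minors e Es))"
      proof (cases r)
        case (OrE \<phi> \<psi> \<chi>)
        then obtain M D1 D2 where Ms: "Ms = [M, D1, D2]" "deduction_in (\<phi> # \<Gamma>) D1"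
          "deduction_in (\<psi> # \<Gamma>) D2" "concl D1 = \<chi>" "concl D2 = \<chi>"
          using r(1) by (auto simp: deduction_in_Infer list_all2_Cons1 simp del: deduction_in.simps(2))
        show ?thesis
          by (rule that[OF Ms(1), of "OrE \<phi> \<psi> (rule_concl e)"])
            (use Ms OrE Infer.prems(1) minors in \<open>auto intro: permutation.intros\<close>)
      next
        case (NegAndE \<phi> \<psi> \<chi>)
        then obtain M D1 D2 where Ms: "Ms = [M, D1, D2]" "deduction_in (Neg \<phi> # \<Gamma>) D1"
          "deduction_in (Neg \<psi> # \<Gamma>) D2" "concl D1 = \<chi>" "concl D2 = \<chi>"
          using r(1) by (auto simp: deduction_in_Infer list_all2_Cons1 simp del: deduction_in.simps(2))
        show ?thesis
          by (rule that[OF Ms(1), of "NegAndE \<phi> \<psi> (rule_concl e)"])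
            (use Ms NegAndE Infer.prems(1) minors in \<open>auto intro: permutation.intros\<close>)
      qed (use del in auto)
      obtain N1 N2 where N: "cut_free N1" "cut_free N2"
        "reduces (Infer e (D1 # lift_minors e Es)) N1"
        "reduces (Infer e (D2 # lift_minors e Es)) N2"
        using D12 unfolding normalizable_def by blast
      \<comment> \<open>Since del-rules are E-rules, cut-freeness of the old major deduction says
        that \<open>M\<close> is not cut-headed, so the new del-inference on \<open>M\<close> is no
        cut either.\<close>
      have "is_E_rule r" using del by (cases r) auto
      then have "cut_free (Infer d [M, N1, N2])"
        using Infer.prems(4) N Ms by auto
      moreover have "reduces
          (Infer d [M, Infer e (D1 # lift_minors e Es), Infer e (D2 # lift_minors e Es)])
          (Infer d [M, N1, N2])"
        using N by (intro reduces_Infer) auto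
      ultimately show ?thesis
        using d(3) normalizable_converts converts.intros(2) normalizable_reduces
          cut_free_normalizable by metis
    qed
  qed
  then show ?thesis unfolding elims_normalizable_def by blast
qed

text \<open>The last conjunct is the invariant that bounds new cuts: a major premise that becomes
  cut-headed without having been so has size at most \<open>n\<close>, which brings it within reach
  of \<open>elims_normalizable\<close>.\<close>

lemma reduces_subst:
  assumes "elims_normalizable TYPE('v) n" "size (concl S) \<le> n"
  shows "deduction_in (\<Gamma>1 @ concl S # \<Gamma>2) D \<Longrightarrow> deduction_in (\<Gamma>1 @ \<Gamma>2) (S :: 'v ded) \<Longrightarrow>
     cut_free S \<Longrightarrow> cut_free D \<Longrightarrow>
     \<exists>N. reduces (subst (length \<Gamma>1) S D) N \<and> cut_free N \<and>
       (cut_headed N \<longrightarrow> cut_headed D \<or> size (concl D) \<le> n)"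
  \<comment> \<open>\<open>S\<close> is lifted in the induction, so its size bound is carried
    along.\<close>
  using assms(2)
proof (induction D arbitrary: \<Gamma>1 S)
  case (Asm i \<alpha>)
  \<comment> \<open>If the leaf is replaced, its formula is \<open>concl S\<close> and the size
    bound holds; otherwise a leaf remains, which is not cut-headed.\<close>
  then show ?case
    by (intro exI[of _ "subst (length \<Gamma>1) S (Asm i \<alpha>)"]) auto
next
  case (Infer r Ds)
  let ?D = "\<lambda>i. subst (length \<Gamma>1 + discharges r i) ((lift 0 ^^ discharges r i) S) (Ds ! i)"
  have "\<exists>N. reduces (?D i) N \<and> cut_free N \<and>
      (cut_headed N \<longrightarrow> cut_headed (Ds ! i) \<or> size (concl (Ds ! i)) \<le> n)"
    if i: "i < length Ds" for i
  proof -
    let ?\<Delta> = "fst (prems r ! i)" and ?S = "(lift 0 ^^ discharges r i) S"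
    have "deduction_in ((?\<Delta> @ \<Gamma>1) @ \<Gamma>2) ?S"
      using deduction_in_lift_funpow[OF Infer.prems(2), of ?\<Delta>] by (simp add: discharges_def)
    then show ?thesis
      using Infer.IH[of "Ds ! i" "?\<Delta> @ \<Gamma>1" ?S] Infer.prems i
      by (simp add: discharges_def add.commute cut_free_lift_funpow)
  qed
  then obtain N where N: "\<And>i. i < length Ds \<Longrightarrow> reduces (?D i) (N i) \<and> cut_free (N i) \<and>
      (cut_headed (N i) \<longrightarrow> cut_headed (Ds ! i) \<or> size (concl (Ds ! i)) \<le> n)"
    by metis
  let ?Ns = "map N [0..<length Ds]"
  have red: "reduces (subst (length \<Gamma>1) S (Infer r Ds)) (Infer r ?Ns)"
    using N by (auto intro!: reduces_Infer simp: list_all2_conv_all_nth)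
  show ?case
  proof (cases "is_E_rule r \<and> cut_headed (N 0)")
    \<comment> \<open>No cut arises at the root, and the last rule is still \<open>r\<close>, so
      cut-headedness is unchanged.\<close>
    case False
    then have "cut_free (Infer r ?Ns)" using N by (auto simp: nth_append)
    then show ?thesis using red by (intro exI[of _ "Infer r ?Ns"]) auto
  next
    case True
    have len: "0 < length Ds"
      using Infer.prems(1) True E_rule_major[of r] by auto
    \<comment> \<open>The major premise has become cut-headed only through the substitution, so the
      invariant bounds its size.\<close>
    have "\<not> cut_headed (Ds ! 0)" using Infer.prems(4) True len by auto
    then have n: "size (concl (Ds ! 0)) \<le> n" using N[OF len] True by blast
    have major: "concl (Ds ! 0) = snd (prems r ! 0)" using Infer.prems(1) len by auto
    have ded: "deduction_in (\<Gamma>1 @ \<Gamma>2) (Infer r ?Ns)"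
      using reduces_preserves[OF red] deduction_in_subst[OF Infer.prems(1,2)] by blast
    then have "concl (N 0) = concl (Ds ! 0)" using len major by auto
    moreover have "?Ns = N 0 # map N [1..<length Ds]"
      using len by (simp add: upt_conv_Cons)
    moreover have "\<forall>D \<in> set ?Ns. cut_free D" using N by auto
    ultimately have "normalizable (Infer r ?Ns)"
      using assms(1) True ded n unfolding elims_normalizable_def by metis
    then obtain N' where "reduces (Infer r ?Ns) N'" "cut_free N'"
      unfolding normalizable_def by blast
    \<comment> \<open>The invariant is passed on: with a del-rule the original deduction is
      cut-headed, and any other E-rule has a conclusion smaller than its major premise.\<close>
    moreover have "is_del_rule r \<or> size (rule_concl r) \<le> n"
      using size_concl_less_major[of r] True n major by fastforce
    ultimately show ?thesis using red by (auto intro: rtranclp_trans)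
  qed
qed

text \<open>Eliminations at a bound give substitutions at the same bound, and substitutions at all
  bounds below \<open>n\<close> give eliminations at \<open>n\<close>.\<close>

lemma elims_normalizable: "elims_normalizable TYPE('v) n"
proof (induction n rule: less_induct)
  case (less n)
  have "substs_normalizable TYPE('v) m" if "m < n" for m
    using reduces_subst[OF less[OF that]]
    unfolding substs_normalizable_def normalizable_def by blast
  then show ?case by (rule elims_normalizable_step)
qed

section \<open>Normalization of all deductions\<close>

lemma deduction_in_normalizable: "deduction_in \<Gamma> D \<Longrightarrow> normalizable D"
proof (induction D arbitrary: \<Gamma>)
  case (Asm i \<alpha>)
  then show ?case by (intro cut_free_normalizable) simp
next
  case (Infer r Ds)
  have "\<exists>N. reduces (Ds ! i) N \<and> cut_free N" if "i < length Ds" for i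
    using Infer that nth_mem[OF that] unfolding normalizable_def by (metis deduction_in.simps(2) lessThan_iff)
  then obtain N where N: "\<And>i. i < length Ds \<Longrightarrow> reduces (Ds ! i) (N i) \<and> cut_free (N i)"
    by metis
  let ?Ns = "map N [0..<length Ds]"
  have red: "reduces (Infer r Ds) (Infer r ?Ns)"
    using N by (auto intro!: reduces_Infer simp: list_all2_conv_all_nth)
  have cf: "\<forall>D \<in> set ?Ns. cut_free D" using N by auto
  have "normalizable (Infer r ?Ns)"
  proof (cases "is_E_rule r \<and> Ds \<noteq> []")
    case False
    then show ?thesis using cf by (intro cut_free_normalizable) auto
  next
    case True
    then have "?Ns = N 0 # map N [1..<length Ds]" by (simp add: upt_conv_Cons)
    \<comment> \<open>The premises are already cut-free; the bound is the size of the major premise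
      itself.\<close>
    then show ?thesis
      using elims_normalizable True cf reduces_preserves[OF red Infer.prems]
      unfolding elims_normalizable_def by (metis le_refl)
  qed
  then show ?case using red normalizable_reduces by blast
qed

theorem theorem3p8:
  fixes D :: "'v ded"
  assumes "deduction D"
    and "atomic_BotE D"
  shows "\<exists>D'. reduces D D' \<and> deduction D' \<and> normal D' \<and>
           concl D' = concl D \<and> open_assms D' \<subseteq> open_assms D"
proof -
  obtain D' where "reduces D D'" "cut_free D'"
    using deduction_in_normalizable[OF assms(1)] unfolding normalizable_def by blast
  then show ?thesis
    using reduces_preserves[OF _ assms(1)] cut_free_imp_normal by blast
qed

end
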